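(* Let $\gamma$ be any real analytic function on $[0,T)$ with $T\le\infty$. Then there exists $u_0\in L^1_\varepsilon(\mathbb{R}^d)$ for some $\varepsilon>0$ such that $u(t)=S(t)u_0$, given by $$u(x,t)=S(t)u_0(x)=\frac{1}{(4\pi t)^{d/2}}\int_{\mathbb{R}^d}e^{-|x-y|^2/4t}u_0(y)\,\mathrm{d}y,$$ is defined for all $t\in[0,T)$ and such that $$u(0,t)=\gamma(t),\qquad 0\le t<T.$$
   Context: $L^1_\varepsilon(\mathbb{R}^d)=\{f\in L^1_{\rm loc}(\mathbb{R}^d):\int_{\mathbb{R}^d}e^{-\varepsilon|x|^2}|f(x)|\,\mathrm{d}x<\infty\}$. The integral formula is the heat kernel representation of the solution of the heat equation $u_t-\Delta u=0$ on $\mathbb{R}^d$ with initial data $u_0$, and $S(0)u_0=u_0$. The functions $u_0$ and $u$ are real-valued and may change sign.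
   Formalization: Added hypothesis: γ on (0,T) extends holomorphically to the disc with diameter (0,T) (half-plane Re z>0 if T=∞). This is necessary for the conclusion; without it the claim fails, e.g. γ(t)=1/(1+100(t−1)²), T=∞. *)

theory Defs
  imports "HOL-Complex_Analysis.Complex_Analysis"
begin

definition Lloc1 :: "('a::euclidean_space \<Rightarrow> real) set" where
  "Lloc1 = {f. \<forall>K. compact K \<longrightarrow> set_integrable lebesgue K f}"

definition L1_eps :: "real \<Rightarrow> ('a::euclidean_space \<Rightarrow> real) set" where
  "L1_eps \<epsilon> = {f \<in> Lloc1. integrable lebesgue (\<lambda>x. exp (- (\<epsilon> * (norm x)\<^sup>2)) * \<bar>f x\<bar>)}"

text \<open>
  The initial datum is a function rather than a class modulo null sets, so that \<open>S(0) u\<^sub>0 = u\<^sub>0\<close>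
  holds at every point.
\<close>

definition heat_integrand :: "real \<Rightarrow> ('a::euclidean_space \<Rightarrow> real) \<Rightarrow> 'a \<Rightarrow> 'a \<Rightarrow> real" where
  "heat_integrand t u0 x y = exp (- ((norm (x - y))\<^sup>2 / (4 * t))) * u0 y"

definition heat_S :: "real \<Rightarrow> ('a::euclidean_space \<Rightarrow> real) \<Rightarrow> 'a \<Rightarrow> real" where
  "heat_S t u0 x =
     (if t = 0 then u0 x
      else 1 / ((4 * pi * t) powr (real DIM('a) / 2))
             * (LINT y|lebesgue. heat_integrand t u0 x y))"

text \<open>
  The Bochner integral is \<open>0\<close> for non-integrable functions; that \<open>S(t) u\<^sub>0\<close> is defined has to be
  said separately.
\<close>

definition heat_S_defined :: "real \<Rightarrow> ('a::euclidean_space \<Rightarrow> real) \<Rightarrow> bool" where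
  "heat_S_defined t u0 \<longleftrightarrow> t = 0 \<or> (\<forall>x. integrable lebesgue (heat_integrand t u0 x))"

text \<open>
  At an endpoint belonging to an interval \<open>S\<close> this is the one-sided condition, which is the
  same as having a real analytic extension past that endpoint.
\<close>

definition real_analytic_on :: "(real \<Rightarrow> real) \<Rightarrow> real set \<Rightarrow> bool" where
  "real_analytic_on f S \<longleftrightarrow>
     (\<forall>s\<in>S. \<exists>(a::nat \<Rightarrow> real) r. 0 < r \<and>
        (\<forall>t\<in>S. \<bar>t - s\<bar> < r \<longrightarrow> (\<lambda>n. a n * (t - s) ^ n) sums f t))"

text \<open>
  \<open>heat_disc T\<close> is the open disc having the segment from \<open>0\<close> to \<open>T\<close> as a diameter, and the
  half-plane \<open>Re z > 0\<close> if \<open>T = \<infinity>\<close>; equivalently \<open>Re (1 / z) > 1 / T\<close>.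

  If the heat integral of \<open>u\<^sub>0\<close> at \<open>x = 0\<close> converges for all \<open>0 < t < T\<close>, then, replacing \<open>t\<close> by a
  complex \<open>z\<close>, it converges and is holomorphic on \<open>heat_disc T\<close>.  So every \<open>\<gamma>\<close> of the form
  \<open>\<gamma>(t) = (S(t) u\<^sub>0)(0)\<close>, \<open>0 < t < T\<close>, extends holomorphically to that disc.  Real analyticity of
  \<open>\<gamma>\<close> on \<open>[0,T)\<close> does not give this: \<open>\<gamma>(t) = 1 / (1 + 100 (t - 1)\<^sup>2)\<close> with \<open>T = \<infinity>\<close> has poles at
  \<open>1 \<plusminus> \<i>/10\<close> and so is not of this form.  The extension is automatic when \<open>\<gamma>\<close> is
  the sum of its Taylor series at \<open>0\<close> on all of \<open>[0,T)\<close>.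
\<close>

definition heat_disc :: "ereal \<Rightarrow> complex set" where
  "heat_disc T = {z. 0 < Re z \<and> ereal ((cmod z)\<^sup>2 / Re z) < T}"

definition extends_to_heat_disc :: "(real \<Rightarrow> real) \<Rightarrow> ereal \<Rightarrow> bool" where
  "extends_to_heat_disc \<gamma> T \<longleftrightarrow>
     (\<exists>G. G holomorphic_on heat_disc T \<and>
        (\<forall>t. 0 < t \<and> ereal t < T \<longrightarrow> G (of_real t) = of_real (\<gamma> t)))"

end

theory Submission
  imports Defs "HOL-Probability.Distributions"
begin

text \<open>
  Even moments of a Gaussian are monomials in the variance: in one space dimension the heat
  semigroup sends \<open>y\<^sup>2\<^sup>n n! / (2 n)!\<close> to a function whose value at the origin is \<open>t\<^sup>n\<close>.  So if
  \<open>\<gamma>(t) = \<Sum> a\<^sub>n t\<^sup>n\<close> near \<open>0\<close>, the natural datum is \<open>v(y) = \<Sum> a\<^sub>n n! / (2 n)! y\<^sup>2\<^sup>n\<close>, which is an entire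
  function; in several dimensions \<open>v\<close> is applied to a single coordinate, the other coordinates
  contributing Gaussians of mass one.  Integration term by term (\<open>integral_heat_profile\<close>) gives
  \<open>(S(t) v)(0) = \<gamma>(t)\<close> inside the disc of convergence of the Taylor series.

  For larger \<open>t\<close> both the convergence of the integral and its value come from a change of Gaussian
  weight.  Multiplication of \<open>v\<close> by \<open>exp (M y\<^sup>2 / 4)\<close> yields a series of the same shape with new
  coefficients \<open>b\<^sub>n\<close> (\<open>heat_profile_twist\<close>), and moves the weight \<open>exp (- y\<^sup>2 / 4 t)\<close> to
  \<open>exp (- y\<^sup>2 / 4 w)\<close> with \<open>1 / w = 1 / t + M\<close>.  Comparison of the two integrals for small times
  identifies the generating function of the \<open>b\<^sub>n\<close> as
  \<open>K(w) = \<gamma>(w / (1 - M w)) / \<surd>(1 - M w)\<close> (\<open>twist_powser_small\<close>).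

  The substitution \<open>w \<mapsto> w / (1 - M w)\<close> is the translation by \<open>- M\<close> in the variable \<open>p = 1 / t\<close>.  In
  that variable \<open>\<gamma>\<close> is holomorphic on the half-plane \<open>Re p > 1 / T\<close> and outside a large disc around
  \<open>0\<close>, hence outside any disc whose boundary passes to the right of \<open>1 / T\<close>, provided that its centre
  \<open>- M\<close> lies far enough to the left (\<open>twist_ball_image\<close>).  So for every \<open>\<tau> < T\<close> and \<open>M\<close> large, \<open>K\<close> is
  holomorphic on the disc of radius \<open>1 / (M + 1 / \<tau>)\<close>, its Taylor series \<open>\<Sum> b\<^sub>n w\<^sup>n\<close> converges there,
  and integration term by term, now with the coefficients \<open>b\<^sub>n\<close>, is justified for all \<open>t < \<tau>\<close>
  (\<open>heat_profile_represents\<close>).  The datum \<open>v\<close> itself does not depend on \<open>M\<close> or \<open>\<tau>\<close>.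
\<close>

section \<open>Even moments of the heat kernel\<close>

definition even_moment :: "nat \<Rightarrow> real" where
  "even_moment n = fact (2 * n) / fact n"

lemma even_moment_pos: "0 < even_moment n"
  by (simp add: even_moment_def)

lemma even_moment_Suc: "even_moment (Suc n) = 2 * (2 * real n + 1) * even_moment n"
proof -
  have "fact (2 * Suc n) = (2 * real n + 2) * (2 * real n + 1) * fact (2 * n)"
    by (simp add: algebra_simps)
  then show ?thesis
    by (simp add: even_moment_def divide_simps) (simp add: algebra_simps)
qed

lemma fact_le_even_moment: "fact n \<le> even_moment n"
proof (induction n)
  case (Suc n)
  have "fact (Suc n) = (real n + 1) * fact n"
    by simp
  also have "\<dots> \<le> (2 * (2 * real n + 1)) * even_moment n"
    using Suc by (intro mult_mono) auto
  finally show ?case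
    by (simp add: even_moment_Suc)
qed (simp add: even_moment_def)

text \<open>
  The heat kernel at time \<open>t\<close> on the line is the normal density of variance \<open>2 t\<close>.
\<close>

lemma has_integral_even_moment:
  assumes "0 < t"
  shows "has_bochner_integral lborel
           (\<lambda>y. normal_density 0 (sqrt (2 * t)) y * (y\<^sup>2) ^ n) (even_moment n * t ^ n)"
proof -
  have "has_bochner_integral lborel (\<lambda>y. normal_density 0 (sqrt (2 * t)) y * (y - 0) ^ (2 * n))
          (fact (2 * n) / ((2 / (sqrt (2 * t))\<^sup>2) ^ n * fact n))"
    by (rule normal_moment_even) (use assms in simp)
  then show ?thesis
    using assms by (simp add: even_moment_def power_divide flip: power_mult)
qed

text \<open>
  The candidate for the initial datum on the line: its image under the heat semigroup is formally
  \<open>\<Sum> a\<^sub>n t\<^sup>n\<close> at the origin.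
\<close>

definition heat_profile :: "(nat \<Rightarrow> real) \<Rightarrow> real \<Rightarrow> real" where
  "heat_profile a y = (\<Sum>n. a n / even_moment n * (y\<^sup>2) ^ n)"

lemma powser_coeff_bound:
  fixes a :: "nat \<Rightarrow> real"
  assumes "summable (\<lambda>n. a n * r ^ n)" "0 < r"
  obtains C where "\<And>n. \<bar>a n\<bar> \<le> C * (1 / r) ^ n"
proof -
  have "Bseq (\<lambda>n. a n * r ^ n)"
    using assms(1) by (intro convergent_imp_Bseq) (auto simp: convergent_def dest: summable_LIMSEQ_zero)
  then obtain C where C: "\<And>n. norm (a n * r ^ n) \<le> C"
    by (auto simp: Bseq_def)
  show ?thesis
  proof (rule that[of C])
    fix n show "\<bar>a n\<bar> \<le> C * (1 / r) ^ n"
      using C[of n] assms(2) by (simp add: abs_mult field_simps)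
  qed
qed

text \<open>
  The moments grow at least like \<open>n!\<close>, so any positive radius of convergence of \<open>\<Sum> a\<^sub>n t\<^sup>n\<close> makes the
  profile an entire function.
\<close>

lemma summable_heat_profile:
  assumes a: "summable (\<lambda>n. \<bar>a n\<bar> * t ^ n)" and t: "0 < t"
  shows "summable (\<lambda>n. norm (a n / even_moment n * x ^ n))"
proof -
  obtain C where C: "\<And>n. \<bar>\<bar>a n\<bar>\<bar> \<le> C * (1 / t) ^ n"
    using powser_coeff_bound[OF a t] by blast
  have "summable (\<lambda>n. C * (norm ((\<bar>x\<bar> / t) ^ n /\<^sub>R fact n)))"
    by (intro summable_mult summable_norm_exp)
  then show ?thesis
  proof (rule summable_comparison_test')
    fix n :: nat
    have "norm (norm (a n / even_moment n * x ^ n)) = \<bar>a n\<bar> * \<bar>x\<bar> ^ n / even_moment n"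
      using even_moment_pos[of n] by (simp add: abs_mult power_abs)
    also have "\<dots> \<le> C * (1 / t) ^ n * \<bar>x\<bar> ^ n / fact n"
    proof (rule frac_le)
      show "\<bar>a n\<bar> * \<bar>x\<bar> ^ n \<le> C * (1 / t) ^ n * \<bar>x\<bar> ^ n"
        using C[of n] by (intro mult_right_mono) auto
      then show "0 \<le> C * (1 / t) ^ n * \<bar>x\<bar> ^ n"
        by (rule order_trans[rotated]) simp
    qed (use fact_le_even_moment[of n] in auto)
    also have "\<dots> = C * (norm ((\<bar>x\<bar> / t) ^ n /\<^sub>R fact n))"
      using t by (simp add: field_simps)
    finally show "norm (norm (a n / even_moment n * x ^ n)) \<le> C * (norm ((\<bar>x\<bar> / t) ^ n /\<^sub>R fact n))" .
  qed
qed

lemma continuous_heat_profile: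
  assumes a: "summable (\<lambda>n. \<bar>a n\<bar> * t ^ n)" and t: "0 < t"
  shows "continuous_on UNIV (heat_profile a)"
proof -
  have "isCont (\<lambda>s. \<Sum>n. a n / even_moment n * s ^ n) x" for x
    by (rule isCont_powser_converges_everywhere)
       (rule summable_norm_cancel[OF summable_heat_profile[OF a t]])
  then have "continuous_on UNIV (\<lambda>s. \<Sum>n. a n / even_moment n * s ^ n)"
    by (simp add: continuous_at_imp_continuous_on)
  then have "continuous_on UNIV ((\<lambda>s. \<Sum>n. a n / even_moment n * s ^ n) \<circ> (\<lambda>y. y\<^sup>2))"
    by (intro continuous_on_compose continuous_intros) (auto intro: continuous_on_subset)
  then show ?thesis
    by (simp add: heat_profile_def[abs_def] comp_def)
qed

text \<open>
  All powers \<open>y\<^sup>2\<^sup>n\<close> are nonnegative, so the integrals of the absolute values of the terms are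
  \<open>\<bar>a\<^sub>n\<bar> t\<^sup>n\<close> exactly: absolute convergence of the power series is what dominated convergence needs.
\<close>

lemma integral_heat_profile:
  assumes a: "summable (\<lambda>n. \<bar>a n\<bar> * t ^ n)" and t: "0 < t"
  shows "integrable lborel (\<lambda>y. normal_density 0 (sqrt (2 * t)) y * heat_profile a y)"
    and "(\<lambda>n. a n * t ^ n) sums (LINT y|lborel. normal_density 0 (sqrt (2 * t)) y * heat_profile a y)"
proof -
  let ?f = "\<lambda>n y. (a n / even_moment n) * (normal_density 0 (sqrt (2 * t)) y * (y\<^sup>2) ^ n)"
  have hb: "has_bochner_integral lborel (?f n) (a n / even_moment n * (even_moment n * t ^ n))" for n
    by (intro has_bochner_integral_mult_right has_integral_even_moment t)
  have int: "integrable lborel (?f n)" and val: "integral\<^sup>L lborel (?f n) = a n * t ^ n" for n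
    using hb[of n] even_moment_pos[of n] by (auto simp: has_bochner_integral_iff)
  have norm_eq: "norm (?f n y) = (\<bar>a n\<bar> / even_moment n) * (normal_density 0 (sqrt (2 * t)) y * (y\<^sup>2) ^ n)"
    for n y using even_moment_pos[of n] by (simp add: abs_mult)
  have "has_bochner_integral lborel (\<lambda>y. norm (?f n y)) (\<bar>a n\<bar> / even_moment n * (even_moment n * t ^ n))" for n
    unfolding norm_eq by (intro has_bochner_integral_mult_right has_integral_even_moment t)
  then have "(LINT y|lborel. norm (?f n y)) = \<bar>a n\<bar> / even_moment n * (even_moment n * t ^ n)" for n
    by (rule has_bochner_integral_integral_eq)
  moreover have "\<bar>a n\<bar> / even_moment n * (even_moment n * t ^ n) = \<bar>a n\<bar> * t ^ n" for n
    using even_moment_pos[of n] by simp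
  ultimately have normval: "(LINT y|lborel. norm (?f n y)) = \<bar>a n\<bar> * t ^ n" for n
    by metis
  have sums: "(\<lambda>n. ?f n y) sums (normal_density 0 (sqrt (2 * t)) y * heat_profile a y)" for y
    unfolding heat_profile_def
    using sums_mult[OF summable_sums[OF summable_norm_cancel[OF summable_heat_profile[OF a t, of "y\<^sup>2"]]],
        of "normal_density 0 (sqrt (2 * t)) y"]
    by (simp add: mult_ac)
  have summ: "AE y in lborel. summable (\<lambda>n. norm (?f n y))"
  proof (rule AE_I2)
    fix y :: real
    show "summable (\<lambda>n. norm (?f n y))"
      using summable_mult[OF summable_heat_profile[OF a t, of "y\<^sup>2"], of "normal_density 0 (sqrt (2 * t)) y"]
      by (simp add: abs_mult mult_ac)
  qed
  have summ2: "summable (\<lambda>n. LINT y|lborel. norm (?f n y))"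
    unfolding normval by (rule a)
  have eq: "(\<Sum>n. ?f n y) = normal_density 0 (sqrt (2 * t)) y * heat_profile a y" for y
    using sums[of y] by (rule sums_unique[symmetric])
  show "integrable lborel (\<lambda>y. normal_density 0 (sqrt (2 * t)) y * heat_profile a y)"
    using integrable_suminf[OF int summ summ2] unfolding eq .
  show "(\<lambda>n. a n * t ^ n) sums (LINT y|lborel. normal_density 0 (sqrt (2 * t)) y * heat_profile a y)"
    using sums_integral[OF int summ summ2] unfolding eq val .
qed

section \<open>Changing the Gaussian weight\<close>

text \<open>
  These are the coefficients that make \<open>exp (M y\<^sup>2 / 4)\<close> times the profile of \<open>a\<close> a profile again,
  namely the Cauchy product with the exponential series.
\<close>

definition gaussian_twist :: "real \<Rightarrow> (nat \<Rightarrow> real) \<Rightarrow> nat \<Rightarrow> real" where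
  "gaussian_twist M a n =
     even_moment n * (\<Sum>k\<le>n. a k / even_moment k * ((M / 4) ^ (n - k) / fact (n - k)))"

lemma heat_profile_twist:
  assumes a: "summable (\<lambda>n. \<bar>a n\<bar> * t ^ n)" and t: "0 < t"
  shows "heat_profile (gaussian_twist M a) y = exp (M * y\<^sup>2 / 4) * heat_profile a y"
proof -
  let ?u = "\<lambda>n. a n / even_moment n * (y\<^sup>2) ^ n"
  let ?e = "\<lambda>n. (M * y\<^sup>2 / 4) ^ n /\<^sub>R fact n"
  have "(\<lambda>n. \<Sum>k\<le>n. ?u k * ?e (n - k)) sums ((\<Sum>n. ?u n) * (\<Sum>n. ?e n))"
    by (intro Cauchy_product_sums summable_heat_profile[OF a t] summable_norm_exp)
  moreover have "(\<Sum>k\<le>n. ?u k * ?e (n - k)) = gaussian_twist M a n / even_moment n * (y\<^sup>2) ^ n" for n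
  proof -
    have "(\<Sum>k\<le>n. ?u k * ?e (n - k)) =
        (\<Sum>k\<le>n. a k / even_moment k * ((M / 4) ^ (n - k) / fact (n - k)) * (y\<^sup>2) ^ n)"
    proof (rule sum.cong[OF refl])
      fix k assume "k \<in> {..n}"
      then have A: "(y\<^sup>2) ^ n = (y\<^sup>2) ^ k * (y\<^sup>2) ^ (n - k)"
        by (simp flip: power_add)
      have B: "(M * y\<^sup>2 / 4) ^ (n - k) = (M / 4) ^ (n - k) * (y\<^sup>2) ^ (n - k)"
        by (simp flip: power_mult_distrib)
      show "?u k * ?e (n - k)
          = a k / even_moment k * ((M / 4) ^ (n - k) / fact (n - k)) * (y\<^sup>2) ^ n"
        unfolding A B by (simp add: inverse_eq_divide mult_ac)
    qed
    then show ?thesis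
      using even_moment_pos[of n] by (simp add: gaussian_twist_def sum_distrib_right)
  qed
  ultimately have "(\<lambda>n. gaussian_twist M a n / even_moment n * (y\<^sup>2) ^ n) sums
      ((\<Sum>n. ?u n) * (\<Sum>n. ?e n))"
    by (simp only:)
  then have "heat_profile (gaussian_twist M a) y = (\<Sum>n. ?u n) * (\<Sum>n. ?e n)"
    unfolding heat_profile_def by (rule sums_unique[symmetric])
  then show ?thesis
    unfolding heat_profile_def exp_def by (rule trans[OF _ mult.commute])
qed

text \<open>
  The quotient is \<open>binomial (2 n) n / 4\<^sup>n\<close>.  It compares the weights in \<open>gaussian_twist\<close> with binomial
  coefficients.
\<close>

lemma even_moment_quotient_mono:
  assumes "k \<le> n"
  shows "even_moment n / (4 ^ n * fact n) \<le> even_moment k / (4 ^ k * fact k)"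
  using assms
proof (induction n rule: dec_induct)
  case (step n)
  have "even_moment (Suc n) / (4 ^ Suc n * fact (Suc n))
      = (2 * (2 * real n + 1)) / (4 * (real n + 1)) * (even_moment n / (4 ^ n * fact n))"
    by (simp add: even_moment_Suc divide_simps)
  also have "\<dots> \<le> 1 * (even_moment n / (4 ^ n * fact n))"
    using even_moment_pos[of n] by (intro mult_right_mono) (auto simp: divide_simps)
  finally show ?case using step.IH by simp
qed simp

text \<open>
  With binomial coefficients as weights, the bound is the binomial theorem.
\<close>

lemma gaussian_twist_bound:
  assumes M: "0 \<le> M" and R: "0 \<le> R" and a: "\<And>n. \<bar>a n\<bar> \<le> C * R ^ n"
  shows "\<bar>gaussian_twist M a n\<bar> \<le> C * (R + M) ^ n"
proof -
  have C: "0 \<le> C" using a[of 0] by simp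
  have "\<bar>gaussian_twist M a n\<bar>
      = even_moment n * \<bar>\<Sum>k\<le>n. a k / even_moment k * ((M / 4) ^ (n - k) / fact (n - k))\<bar>"
    using even_moment_pos[of n] by (simp add: gaussian_twist_def abs_mult)
  also have "\<dots> \<le> even_moment n * (\<Sum>k\<le>n. \<bar>a k / even_moment k * ((M / 4) ^ (n - k) / fact (n - k))\<bar>)"
    using even_moment_pos[of n] by (intro mult_left_mono sum_abs) auto
  also have "\<dots> = (\<Sum>k\<le>n. even_moment n * \<bar>a k / even_moment k * ((M / 4) ^ (n - k) / fact (n - k))\<bar>)"
    by (simp add: sum_distrib_left)
  also have "\<dots> \<le> (\<Sum>k\<le>n. C * (real (n choose k) * R ^ k * M ^ (n - k)))"
  proof (rule sum_mono)
    fix k assume "k \<in> {..n}"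
    then have k: "k \<le> n" by simp
    have p4: "(4::real) ^ n = 4 ^ k * 4 ^ (n - k)"
      using k by (simp flip: power_add)
    have "even_moment n * \<bar>a k / even_moment k * ((M / 4) ^ (n - k) / fact (n - k))\<bar>
        = (even_moment n / even_moment k / (4 ^ (n - k) * fact (n - k))) * (\<bar>a k\<bar> * M ^ (n - k))"
      using M even_moment_pos[of k] by (simp add: abs_mult power_divide)
    also have "\<dots> \<le> real (n choose k) * ((C * R ^ k) * M ^ (n - k))"
    proof (rule mult_mono)
      show "even_moment n / even_moment k / (4 ^ (n - k) * fact (n - k)) \<le> real (n choose k)"
        using even_moment_quotient_mono[OF k] even_moment_pos[of k] even_moment_pos[of n]
        unfolding binomial_fact[OF k] p4 by (simp add: divide_simps mult_ac)
      show "\<bar>a k\<bar> * M ^ (n - k) \<le> (C * R ^ k) * M ^ (n - k)"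
        using a[of k] M by (intro mult_right_mono) auto
    qed (use M in auto)
    finally show "even_moment n * \<bar>a k / even_moment k * ((M / 4) ^ (n - k) / fact (n - k))\<bar>
        \<le> C * (real (n choose k) * R ^ k * M ^ (n - k))"
      by (simp add: mult_ac)
  qed
  also have "\<dots> = C * (R + M) ^ n"
    by (simp add: binomial_ring sum_distrib_left)
  finally show ?thesis .
qed

lemma twist_integrand:
  assumes a: "summable (\<lambda>n. \<bar>a n\<bar> * r ^ n)" and r: "0 < r"
    and w: "0 < w" "0 < 1 - M * w" and t: "t = w / (1 - M * w)"
  shows "normal_density 0 (sqrt (2 * t)) y * heat_profile a y
       = sqrt (1 - M * w) * (normal_density 0 (sqrt (2 * w)) y * heat_profile (gaussian_twist M a) y)"
proof -
  have tp: "0 < t" using w t by simp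
  have wt: "1 - M * w = w / t" using w t by simp
  have weights: "exp (- (y\<^sup>2 / (4 * w))) * exp (M * y\<^sup>2 / 4) = exp (- (y\<^sup>2 / (4 * t)))"
    using w unfolding t by (simp flip: exp_add) (simp add: field_simps)
  have masses: "sqrt (1 - M * w) / sqrt (4 * pi * w) = 1 / sqrt (4 * pi * t)"
    unfolding wt using w tp by (simp add: real_sqrt_mult real_sqrt_divide)
  have "1 / sqrt (4 * pi * t) * exp (- (y\<^sup>2 / (4 * t)))
      = sqrt (1 - M * w) * (1 / sqrt (4 * pi * w) * exp (- (y\<^sup>2 / (4 * w)))) * exp (M * y\<^sup>2 / 4)"
    unfolding weights[symmetric] masses[symmetric]
    by (simp only: times_divide_eq_right times_divide_eq_left mult_1_right mult.assoc)
  moreover have "normal_density 0 (sqrt (2 * s)) y = 1 / sqrt (4 * pi * s) * exp (- (y\<^sup>2 / (4 * s)))"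
    if "0 < s" for s
    using that by (simp add: normal_density_def mult_ac)
  ultimately have "normal_density 0 (sqrt (2 * t)) y
      = sqrt (1 - M * w) * normal_density 0 (sqrt (2 * w)) y * exp (M * y\<^sup>2 / 4)"
    using w(1) tp by simp
  then show ?thesis
    by (simp add: heat_profile_twist[OF a r])
qed

section \<open>Extending the function across zero\<close>

text \<open>
  The zeros of a power series that does not vanish identically do not accumulate at its centre.
\<close>

lemma powser_zero_on_positive_reals:
  fixes c :: "nat \<Rightarrow> complex"
  assumes r: "0 < r" and sums: "\<And>z. norm z < r \<Longrightarrow> (\<lambda>n. c n * z ^ n) sums f z"
    and s: "0 < s" and zero: "\<And>x::real. 0 < x \<Longrightarrow> x < s \<Longrightarrow> f (of_real x) = 0"
  shows "c n = 0"
proof (rule ccontr)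
  assume c: "c n \<noteq> 0"
  \<comment> \<open>The factor \<open>z\<close> turns the centre into a zero even if \<open>c 0 \<noteq> 0\<close>, so that the isolation of zeros
      applies to \<open>z * f z\<close> for every \<open>n\<close>.\<close>
  define d where "d = case_nat 0 c"
  have "(\<lambda>n. d n * (z - 0) ^ n) sums (z * f z)" if "norm (z - 0) < r" for z
  proof (rule sums_Suc_imp)
    show "(\<lambda>n. d (Suc n) * (z - 0) ^ Suc n) sums (z * f z)"
      using sums_mult[OF sums, of z z] that by (simp add: d_def mult_ac)
  qed (simp add: d_def)
  moreover have "d (Suc n) \<noteq> 0"
    using c by (simp add: d_def)
  ultimately obtain e where e: "0 < e" "\<And>z. z \<in> cball 0 e - {0} \<Longrightarrow> z * f z \<noteq> 0"
    using powser_0_nonzero[of r 0 d "\<lambda>z. z * f z" "Suc n"] r by auto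
  define x where "x = min e (s / 2)"
  have x: "0 < x" "x < s" "x \<le> e"
    using e(1) s by (auto simp: x_def)
  show False
    using e(2)[of "of_real x"] zero[OF x(1,2)] x by simp
qed

lemma heat_disc_ereal:
  assumes "0 < \<tau>"
  shows "heat_disc (ereal \<tau>) = ball (of_real (\<tau> / 2)) (\<tau> / 2)"
proof (rule set_eqI)
  fix z :: complex
  have "z \<in> ball (of_real (\<tau> / 2)) (\<tau> / 2) \<longleftrightarrow> (cmod (of_real (\<tau> / 2) - z))\<^sup>2 < (\<tau> / 2)\<^sup>2"
    unfolding mem_ball dist_norm
  proof
    assume "cmod (complex_of_real (\<tau> / 2) - z) < \<tau> / 2"
    then show "(cmod (complex_of_real (\<tau> / 2) - z))\<^sup>2 < (\<tau> / 2)\<^sup>2"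
      by (rule power_strict_mono) auto
  next
    assume "(cmod (complex_of_real (\<tau> / 2) - z))\<^sup>2 < (\<tau> / 2)\<^sup>2"
    then show "cmod (complex_of_real (\<tau> / 2) - z) < \<tau> / 2"
      by (rule power2_less_imp_less) (use assms in simp)
  qed
  also have "\<dots> \<longleftrightarrow> (cmod z)\<^sup>2 < \<tau> * Re z"
    unfolding cmod_power2 by (simp add: power2_eq_square algebra_simps) argo
  also have "\<dots> \<longleftrightarrow> z \<in> heat_disc (ereal \<tau>)"
  proof
    assume *: "(cmod z)\<^sup>2 < \<tau> * Re z"
    then have "0 < \<tau> * Re z"
      by (rule le_less_trans[rotated]) simp
    then have "0 < Re z"
      using assms by (simp add: zero_less_mult_iff)
    then show "z \<in> heat_disc (ereal \<tau>)"
      using * by (simp add: heat_disc_def divide_simps)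
  next
    assume "z \<in> heat_disc (ereal \<tau>)"
    then show "(cmod z)\<^sup>2 < \<tau> * Re z"
      by (simp add: heat_disc_def divide_simps)
  qed
  finally show "z \<in> heat_disc (ereal \<tau>) \<longleftrightarrow> z \<in> ball (of_real (\<tau> / 2)) (\<tau> / 2)"
    by blast
qed

lemma open_convex_heat_disc:
  assumes "0 < T"
  shows "open (heat_disc T)" "convex (heat_disc T)"
proof -
  consider \<tau> where "T = ereal \<tau>" "0 < \<tau>" | "T = \<infinity>"
    using assms by (cases T) auto
  then have "open (heat_disc T) \<and> convex (heat_disc T)"
  proof cases
    case 1
    then show ?thesis by (simp add: heat_disc_ereal)
  next
    case 2
    then have "heat_disc T = {z. 0 < Re z}"
      by (auto simp: heat_disc_def)
    then show ?thesis
      by (simp add: open_halfspace_Re_gt convex_halfspace_Re_gt)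
  qed
  then show "open (heat_disc T)" "convex (heat_disc T)"
    by auto
qed

lemma of_real_in_heat_disc:
  assumes "0 < t" "ereal t < T"
  shows "of_real t \<in> heat_disc T"
  using assms by (simp add: heat_disc_def power2_eq_square)

text \<open>
  The disc of convergence and \<open>heat_disc T\<close> are both convex, so their intersection is connected and
  the identity theorem allows the two functions to be glued.
\<close>

lemma extend_across_zero:
  fixes a :: "nat \<Rightarrow> real"
  assumes T: "0 < T" and G: "G holomorphic_on heat_disc T"
    and r: "0 < r" "ereal r < T"
    and sums: "\<And>t. 0 < t \<Longrightarrow> t \<le> r \<Longrightarrow> (\<lambda>n. of_real (a n) * of_real t ^ n) sums G (of_real t)"
  obtains H where "H holomorphic_on ball 0 r \<union> heat_disc T"
    "\<And>z. z \<in> ball 0 r \<Longrightarrow> (\<lambda>n. of_real (a n) * z ^ n) sums H z"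
    "\<And>z. z \<in> heat_disc T \<Longrightarrow> H z = G z"
proof -
  define P where "P z = (\<Sum>n. of_real (a n) * z ^ n :: complex)" for z
  have P: "(\<lambda>n. of_real (a n) * z ^ n) sums P z" if "z \<in> ball 0 r" for z
  proof -
    have "summable (\<lambda>n. of_real (a n) * of_real r ^ n :: complex)"
      using sums[of r] r by (auto simp: sums_iff)
    then have "summable (\<lambda>n. of_real (a n) * z ^ n)"
      by (rule powser_inside) (use that r(1) in simp)
    then show ?thesis
      unfolding P_def by (rule summable_sums)
  qed
  then have Phol: "P holomorphic_on ball 0 r"
    using power_series_holomorphic[of 0 r "\<lambda>n. of_real (a n)" P] by simp
  have agree: "P z = G z" if z: "z \<in> ball 0 r" "z \<in> heat_disc T" for z
  proof -
    let ?S = "ball 0 r \<inter> heat_disc T" and ?U = "complex_of_real ` {0<..<r}"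
    have lim: "complex_of_real (r / 2) islimpt ?U"
      unfolding islimpt_approachable
    proof (intro allI impI)
      fix e :: real assume e: "0 < e"
      define x where "x = r / 2 + min (e / 2) (r / 4)"
      have x: "r / 2 < x" "x < r" "x - r / 2 < e"
        using e r(1) by (auto simp: x_def min_def)
      have "dist (complex_of_real x) (of_real (r / 2)) = \<bar>x - r / 2\<bar>"
        by (simp only: dist_norm norm_of_real flip: of_real_diff)
      then show "\<exists>x'\<in>?U. x' \<noteq> complex_of_real (r / 2) \<and> dist x' (complex_of_real (r / 2)) < e"
        using x r(1) by (intro bexI[of _ "complex_of_real x"] conjI) (auto simp del: of_real_divide)
    qed
    have "P z - G z = 0"
    proof (rule analytic_continuation[of "\<lambda>z. P z - G z" ?S ?U "of_real (r / 2)"])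
      show "(\<lambda>z. P z - G z) holomorphic_on ?S"
        by (intro holomorphic_intros) (auto intro: holomorphic_on_subset[OF Phol] holomorphic_on_subset[OF G])
      show "open ?S"
        using open_convex_heat_disc(1)[OF T] by auto
      show "connected ?S"
        using open_convex_heat_disc(2)[OF T] by (intro convex_connected convex_Int) auto
      show "?U \<subseteq> ?S"
      proof safe
        fix t :: real assume t: "t \<in> {0<..<r}"
        then show "complex_of_real t \<in> ball 0 r" by simp
        have "ereal t < T"
          using t by (intro less_trans[OF _ r(2)]) simp
        then show "complex_of_real t \<in> heat_disc T"
          using t by (intro of_real_in_heat_disc) auto
      qed
      then show "complex_of_real (r / 2) \<in> ?S"
        by (rule subsetD) (rule imageI, use r(1) in simp)
      show "complex_of_real (r / 2) islimpt ?U" by (rule lim)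
      fix u assume "u \<in> ?U"
      then obtain t where t: "0 < t" "t < r" "u = of_real t" by auto
      then have "P u = G u"
        using sums[of t] P[of u] by (auto intro: sums_unique2)
      then show "P u - G u = 0" by simp
    qed (use z in auto)
    then show ?thesis by simp
  qed
  let ?H = "\<lambda>z. if z \<in> ball 0 r then P z else G z"
  show ?thesis
  proof (rule that[of ?H])
    show "?H holomorphic_on ball 0 r \<union> heat_disc T"
      by (rule holomorphic_on_If_Un[OF Phol G _ open_convex_heat_disc(1)[OF T] agree]) auto
  qed (use P agree in auto)
qed

text \<open>
  For \<open>w \<noteq> 0\<close> put \<open>p = 1 / w - M\<close>.  The hypothesis on \<open>w\<close> says that \<open>p\<close> lies outside the disc with centre \<open>- M\<close>
  whose rightmost point is \<open>1 / \<tau>\<close>.  Where \<open>\<bar>p\<bar> \<le> 1 / r\<close>, the boundary of that disc deviates from the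
  vertical line \<open>Re p = 1 / \<tau>\<close> by an amount of order \<open>1 / (2 M r\<^sup>2)\<close>; the choice of \<open>M\<close> makes this at
  most the gap \<open>1 / \<tau> - 1 / \<tau>'\<close>, so that \<open>Re p > 1 / \<tau>'\<close>.
\<close>

lemma twist_ball_image:
  fixes w :: complex
  assumes T: "ereal \<tau>' < T" and \<tau>: "0 < \<tau>" "\<tau> < \<tau>'" and r: "0 < r"
    and M: "M = 1 / (2 * (1 / \<tau> - 1 / \<tau>') * r\<^sup>2)"
    and w: "norm w < 1 / (M + 1 / \<tau>)"
  shows "0 < Re (1 - of_real M * w)"
    and "w / (1 - of_real M * w) \<in> ball 0 r \<union> heat_disc T"
proof -
  have \<delta>: "0 < 1 / \<tau> - 1 / \<tau>'"
    using \<tau> by (simp add: field_simps)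
  then have Mpos: "0 < M"
    using r by (simp add: M)
  have Mr: "2 * M * (1 / \<tau> - 1 / \<tau>') = 1 / r\<^sup>2"
    using \<delta> r \<tau> by (simp add: M)
  have \<rho>: "0 < M + 1 / \<tau>"
    using Mpos \<tau> by (simp add: add_pos_pos)
  have "M * norm w < 1"
  proof -
    have "M * norm w \<le> (M + 1 / \<tau>) * norm w"
      using \<tau> by (intro mult_right_mono) auto
    also have "\<dots> < 1"
      using w \<rho> by (simp add: field_simps)
    finally show ?thesis .
  qed
  moreover have "Re (of_real M * w) \<le> M * norm w"
    using complex_Re_le_cmod[of "of_real M * w"] Mpos by (simp add: norm_mult)
  ultimately show re: "0 < Re (1 - of_real M * w)"
    by simp
  let ?z = "w / (1 - of_real M * w)"
  show "?z \<in> ball 0 r \<union> heat_disc T"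
  proof (cases "norm ?z < r")
    case False
    then have w0: "w \<noteq> 0" using r by auto
    have nz: "1 - of_real M * w \<noteq> 0"
      using re by (metis less_irrefl zero_complex.sel(1))
    define p where "p = 1 / w - of_real M"
    have z: "?z = 1 / p"
      using w0 nz by (simp add: p_def field_simps)
    have p0: "p \<noteq> 0"
      using w0 nz by (auto simp: p_def field_simps)
    have "norm p \<le> 1 / r"
      using False p0 r unfolding z by (simp add: norm_divide field_simps)
    then have "(norm p)\<^sup>2 \<le> (1 / r)\<^sup>2"
      by (intro power_mono) auto
    then have np: "(norm p)\<^sup>2 \<le> 2 * M * (1 / \<tau> - 1 / \<tau>')"
      by (simp add: Mr power_divide)
    have "M + 1 / \<tau> < norm (1 / w)"
      using w w0 \<rho> by (simp add: norm_divide field_simps)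
    then have "(M + 1 / \<tau>)\<^sup>2 < (norm (p + of_real M))\<^sup>2"
      using \<rho> by (intro power_strict_mono) (auto simp: p_def)
    also have "(norm (p + of_real M))\<^sup>2 = (norm p)\<^sup>2 + 2 * M * Re p + M\<^sup>2"
      unfolding cmod_power2 by (simp add: power2_eq_square algebra_simps)
    finally have "2 * M * (1 / \<tau>) + (1 / \<tau>)\<^sup>2 < (norm p)\<^sup>2 + 2 * M * Re p"
      by (simp add: power2_eq_square algebra_simps)
    then have "2 * M * (1 / \<tau>) < 2 * M * (1 / \<tau> - 1 / \<tau>') + 2 * M * Re p"
      using np zero_le_power2[of "1 / \<tau>"] by linarith
    then have "2 * M * (1 / \<tau>') < 2 * M * Re p"
      by (simp add: algebra_simps)
    then have "1 / \<tau>' < Re p"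
      using Mpos mult_less_cancel_left_pos[of "2 * M" "1 / \<tau>'" "Re p"] by linarith
    moreover have \<tau>'pos: "0 < \<tau>'" using \<tau> by simp
    ultimately have Rep_pos: "0 < Re p"
      by (meson less_trans zero_less_divide_1_iff)
    then have Rep_inverse: "1 / Re p < \<tau>'"
      using \<open>1 / \<tau>' < Re p\<close> \<tau>'pos by (simp add: field_simps)
    note Rep = Rep_pos Rep_inverse
    have Rez: "Re ?z = Re p / (norm p)\<^sup>2"
      unfolding z by (simp add: Re_divide cmod_power2)
    have "(norm ?z)\<^sup>2 / Re ?z = 1 / Re p"
      unfolding Rez unfolding z using p0 Rep by (simp add: norm_divide power_divide)
    moreover have "0 < Re ?z"
      unfolding Rez using p0 Rep by simp
    moreover have "ereal (1 / Re p) < T"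
      using Rep(2) by (intro less_trans[OF _ T]) simp
    ultimately have "?z \<in> heat_disc T"
      by (simp only: heat_disc_def mem_Collect_eq simp_thms)
    then show ?thesis by blast
  qed auto
qed

section \<open>Representation on the line up to time T\<close>

text \<open>
  Both sides are the same Gaussian integral, once computed with the coefficients \<open>a\<close> and once with
  the twisted ones, so no expansion of \<open>(1 - M w) powr (- k - 1 / 2)\<close> in powers of \<open>w\<close> is required.
\<close>

lemma twist_powser_small:
  fixes a :: "nat \<Rightarrow> real"
  assumes a: "summable (\<lambda>n. a n * r ^ n)" and r: "0 < r" and M: "0 \<le> M"
    and w: "0 < w" "w < 1 / (1 / r + M)" and t: "t = w / (1 - M * w)"
  shows "t < r" "0 < t" "0 < 1 - M * w"
    "(\<Sum>n. a n * t ^ n) = sqrt (1 - M * w) * (\<Sum>n. gaussian_twist M a n * w ^ n)"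
    "summable (\<lambda>n. gaussian_twist M a n * w ^ n)"
proof -
  have "0 < 1 / r + M"
    using r M by (intro add_pos_nonneg) auto
  then have rMw: "(1 / r + M) * w < 1"
    using w(2) by (simp add: field_simps)
  moreover have "0 < (1 / r) * w"
    using w r by simp
  ultimately show Mw: "0 < 1 - M * w"
    by (simp add: algebra_simps)
  show tpos: "0 < t"
    using w Mw by (simp add: t)
  show tr: "t < r"
    using rMw Mw r by (simp add: t field_simps)
  have sa: "summable (\<lambda>n. \<bar>a n\<bar> * t ^ n)"
    using powser_insidea[OF a, of t] tpos tr r by (simp add: abs_mult)
  obtain C where C: "\<And>n. \<bar>a n\<bar> \<le> C * (1 / r) ^ n"
    using powser_coeff_bound[OF a r] by blast
  have bound: "\<bar>gaussian_twist M a n\<bar> \<le> C * (1 / r + M) ^ n" for n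
    by (rule gaussian_twist_bound[OF M _ C]) (use r in simp)
  have sb: "summable (\<lambda>n. \<bar>gaussian_twist M a n\<bar> * w ^ n)"
  proof (rule summable_comparison_test')
    show "summable (\<lambda>n. C * ((1 / r + M) * w) ^ n)"
      using rMw w \<open>0 < 1 / r + M\<close> by (intro summable_mult summable_geometric) simp
    fix n :: nat
    show "norm (\<bar>gaussian_twist M a n\<bar> * w ^ n) \<le> C * ((1 / r + M) * w) ^ n"
      using mult_right_mono[OF bound[of n], of "w ^ n"] w
      by (simp add: power_mult_distrib mult_ac)
  qed
  show "summable (\<lambda>n. gaussian_twist M a n * w ^ n)"
    by (rule summable_norm_cancel) (use sb w in \<open>simp add: abs_mult\<close>)
  have "(\<Sum>n. a n * t ^ n) = (LINT y|lborel. normal_density 0 (sqrt (2 * t)) y * heat_profile a y)"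
    by (rule sums_unique[symmetric, OF integral_heat_profile(2)[OF sa tpos]])
  also have "\<dots> = sqrt (1 - M * w) *
      (LINT y|lborel. normal_density 0 (sqrt (2 * w)) y * heat_profile (gaussian_twist M a) y)"
    by (simp add: twist_integrand[OF sa tpos w(1) Mw t])
  also have "\<dots> = sqrt (1 - M * w) * (\<Sum>n. gaussian_twist M a n * w ^ n)"
    by (simp only: sums_unique[symmetric, OF integral_heat_profile(2)[OF sb w(1)]])
  finally show "(\<Sum>n. a n * t ^ n) = sqrt (1 - M * w) * (\<Sum>n. gaussian_twist M a n * w ^ n)" .
qed

text \<open>
  The function \<open>K\<close> of the introduction is holomorphic on the disc of radius \<open>\<rho> = 1 / (M + 1 / \<tau>)\<close>.
  Its Taylor coefficients are the twisted ones, because the two series agree at small positive reals;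
  hence the twisted series converges at \<open>w = t / (1 + M t) < \<rho>\<close>.
\<close>

lemma heat_profile_represents:
  fixes a :: "nat \<Rightarrow> real"
  assumes T: "0 < T" and G: "G holomorphic_on heat_disc T"
    and G\<gamma>: "\<And>t. 0 < t \<Longrightarrow> ereal t < T \<Longrightarrow> G (of_real t) = of_real (\<gamma> t)"
    and r: "0 < r" "ereal r < T"
    and sums: "\<And>t. 0 < t \<Longrightarrow> t \<le> r \<Longrightarrow> (\<lambda>n. a n * t ^ n) sums \<gamma> t"
    and t: "0 < t" "ereal t < T"
  shows "integrable lborel (\<lambda>y. normal_density 0 (sqrt (2 * t)) y * heat_profile a y)"
    and "(LINT y|lborel. normal_density 0 (sqrt (2 * t)) y * heat_profile a y) = \<gamma> t"
proof -
  have csums: "(\<lambda>n. of_real (a n) * of_real s ^ n) sums G (of_real s)" if "0 < s" "s \<le> r" for s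
  proof -
    have "ereal s < T"
      using that by (intro le_less_trans[OF _ r(2)]) simp
    then show ?thesis
      using sums_of_real[OF sums[OF that], where 'a = complex] G\<gamma>[of s] that by simp
  qed
  from extend_across_zero[OF T G r csums]
  obtain H where H: "H holomorphic_on ball 0 r \<union> heat_disc T"
    and Hsums: "\<And>z. z \<in> ball 0 r \<Longrightarrow> (\<lambda>n. of_real (a n) * z ^ n) sums H z"
    and HG: "\<And>z. z \<in> heat_disc T \<Longrightarrow> H z = G z"
    by blast
  \<comment> \<open>Two intermediate times: \<open>t < \<tau>\<close> puts \<open>w\<close> strictly inside the disc, and the gap between \<open>\<tau>\<close> and
      \<open>\<tau>'\<close> absorbs the curvature of its boundary.\<close>
  obtain \<tau>' where \<tau>': "t < \<tau>'" "ereal \<tau>' < T"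
    using ereal_dense2[OF t(2)] by auto
  obtain \<tau> where \<tau>: "t < \<tau>" "\<tau> < \<tau>'"
    using dense[OF \<tau>'(1)] by blast
  have \<tau>pos: "0 < \<tau>" using t \<tau> by simp
  define M where "M = 1 / (2 * (1 / \<tau> - 1 / \<tau>') * r\<^sup>2)"
  define \<rho> where "\<rho> = 1 / (M + 1 / \<tau>)"
  note image = twist_ball_image[OF \<tau>'(2) \<tau>pos \<tau>(2) r(1) M_def, folded \<rho>_def]
  have "0 < 1 / \<tau> - 1 / \<tau>'"
    using \<tau>pos \<tau> by (simp add: field_simps)
  then have Mpos: "0 < M"
    using r(1) by (simp add: M_def)
  have \<rho>pos: "0 < \<rho>"
    using Mpos \<tau>pos by (simp add: \<rho>_def add_pos_pos)
  define K where "K w = H (w / (1 - of_real M * w)) / csqrt (1 - of_real M * w)" for w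
  define b where "b = gaussian_twist M a"
  have sa: "summable (\<lambda>n. a n * r ^ n)"
    using sums[of r] r(1) by (auto simp: sums_iff)
  have K: "K holomorphic_on ball 0 \<rho>"
    unfolding K_def
  proof (intro holomorphic_on_divide holomorphic_on_csqrt')
    have "(\<lambda>w. w / (1 - of_real M * w)) holomorphic_on ball 0 \<rho>"
      using image(1) by (intro holomorphic_intros) fastforce
    moreover have "(\<lambda>w. w / (1 - of_real M * w)) ` ball 0 \<rho> \<subseteq> ball 0 r \<union> heat_disc T"
      by (intro image_subsetI image(2)) simp
    ultimately show "(\<lambda>w. H (w / (1 - of_real M * w))) holomorphic_on ball 0 \<rho>"
      using holomorphic_on_compose_gen[OF _ H, of "\<lambda>w. w / (1 - of_real M * w)"]
      by (simp add: comp_def)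
    fix w :: complex assume "w \<in> ball 0 \<rho>"
    then have w: "0 < Re (1 - of_real M * w)"
      using image(1)[of w] by simp
    then show "1 - of_real M * w \<notin> \<real>\<^sub>\<le>\<^sub>0"
      by (auto simp: complex_nonpos_Reals_iff)
    show "csqrt (1 - of_real M * w) \<noteq> 0"
      using w by (metis csqrt_eq_0 less_irrefl zero_complex.sel(1))
  qed (intro holomorphic_intros)
  define c where "c n = (deriv ^^ n) K 0 / fact n" for n
  have Ksums: "(\<lambda>n. c n * w ^ n) sums K w" if "norm w < \<rho>" for w
    using holomorphic_power_series[OF K, of w] that by (simp add: c_def)
  have "0 < 1 / (1 / r + M)"
    using r(1) Mpos by (simp add: add_pos_pos)
  then obtain w1 where w1: "0 < w1" "w1 < 1 / (1 / r + M)"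
    using dense by blast
  note small = twist_powser_small[OF sa r(1) less_imp_le[OF Mpos]]
  have Kreal: "K (of_real w) = of_real (\<Sum>n. b n * w ^ n)" if "0 < w" "w < 1 / (1 / r + M)" for w
  proof -
    note sm = small[OF that refl]
    let ?t = "w / (1 - M * w)"
    have "H (of_real ?t) = of_real (\<Sum>n. a n * ?t ^ n)"
    proof (rule sums_unique2[OF Hsums])
      show "complex_of_real ?t \<in> ball 0 r"
        using sm by (simp del: of_real_divide)
      have "summable (\<lambda>n. a n * ?t ^ n)"
        by (rule powser_inside[OF sa]) (use sm r(1) in simp)
      from sums_of_real[OF summable_sums[OF this], where 'a = complex]
      show "(\<lambda>n. of_real (a n) * of_real ?t ^ n) sums complex_of_real (\<Sum>n. a n * ?t ^ n)"
        by simp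
    qed
    moreover have "csqrt (of_real (1 - M * w)) = of_real (sqrt (1 - M * w))"
      using sm by (intro csqrt_of_real) simp
    ultimately show ?thesis
      using sm(3,4) by (simp add: K_def b_def)
  qed
  have cb: "c n = of_real (b n)" for n
  proof -
    define s where "s = min \<rho> w1"
    have s: "0 < s" "s \<le> \<rho>" "s \<le> w1"
      using \<rho>pos w1 by (auto simp: s_def)
    have bsums: "(\<lambda>n. of_real (b n) * w ^ n) sums (\<Sum>n. of_real (b n) * w ^ n)"
      if "norm w < s" for w :: complex
    proof (rule summable_sums, rule powser_inside)
      show "summable (\<lambda>n. of_real (b n) * complex_of_real w1 ^ n)"
        using summable_of_real[OF small(5)[OF w1 refl], where 'a = complex]
        by (simp add: b_def)
      show "norm w < norm (complex_of_real w1)"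
        using that s w1 by simp
    qed
    have "c n - of_real (b n) = 0"
    proof (rule powser_zero_on_positive_reals[OF s(1) _ s(1)])
      fix w :: complex assume w: "norm w < s"
      show "(\<lambda>n. (c n - of_real (b n)) * w ^ n) sums (K w - (\<Sum>n. of_real (b n) * w ^ n))"
        using sums_diff[OF Ksums bsums[OF w]] w s by (simp add: left_diff_distrib)
    next
      fix x :: real assume x: "0 < x" "x < s"
      then have "x < 1 / (1 / r + M)" using s w1 by simp
      note sm = small(5)[OF x(1) this refl] and Kr = Kreal[OF x(1) this]
      have "(\<Sum>n. of_real (b n) * complex_of_real x ^ n) = of_real (\<Sum>n. b n * x ^ n)"
        using suminf_of_real[OF sm, where 'a = complex] by (simp add: b_def)
      then show "K (of_real x) - (\<Sum>n. of_real (b n) * of_real x ^ n) = 0"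
        using Kr by simp
    qed
    then show ?thesis by simp
  qed
  define w where "w = t / (1 + M * t)"
  have Mt: "0 < 1 + M * t"
    using Mpos t by (simp add: add_pos_pos)
  have w: "0 < w" "0 < 1 - M * w" "t = w / (1 - M * w)"
    using t Mt by (auto simp: w_def field_simps)
  have "w < \<rho>"
  proof -
    have "w = 1 / (M + 1 / t)"
      using t Mt by (simp add: w_def field_simps)
    moreover have "1 / \<tau> < 1 / t"
      using t \<tau> by (simp add: field_simps)
    ultimately show ?thesis
      unfolding \<rho>_def using Mpos \<tau>pos t(1)
      by (simp only:) (intro divide_strict_left_mono mult_pos_pos add_pos_pos, auto)
  qed
  then obtain v where v: "w < v" "v < \<rho>"
    using dense by blast
  have "summable (\<lambda>n. of_real (b n) * of_real v ^ n :: complex)"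
    using Ksums[of "of_real v"] v w by (auto simp: cb sums_iff)
  from powser_insidea[OF this, of "of_real w"]
  have sb: "summable (\<lambda>n. \<bar>b n\<bar> * w ^ n)"
    using v w by (simp add: norm_mult norm_power)
  obtain r' where r': "0 < r'" "r' < r"
    using dense[OF r(1)] by blast
  have sa': "summable (\<lambda>n. \<bar>a n\<bar> * r' ^ n)"
    using powser_insidea[OF sa, of r'] r' by (simp add: abs_mult)
  note eq = twist_integrand[OF sa' r'(1) w, folded b_def]
  show "integrable lborel (\<lambda>y. normal_density 0 (sqrt (2 * t)) y * heat_profile a y)"
    unfolding eq by (intro integrable_mult_right integral_heat_profile(1)[OF sb w(1)])
  define I where "I = (LINT y|lborel. normal_density 0 (sqrt (2 * w)) y * heat_profile b y)"
  have "(\<lambda>n. b n * w ^ n) sums I"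
    unfolding I_def by (rule integral_heat_profile(2)[OF sb w(1)])
  from sums_of_real[OF this, where 'a = complex]
  have "(\<lambda>n. c n * of_real w ^ n) sums of_real I"
    by (simp add: cb)
  moreover have "(\<lambda>n. c n * of_real w ^ n) sums K (of_real w)"
    by (rule Ksums) (use w \<open>w < \<rho>\<close> in simp)
  ultimately have "of_real I = K (of_real w)"
    by (rule sums_unique2)
  also have "K (of_real w) = H (of_real t) / of_real (sqrt (1 - M * w))"
    using csqrt_of_real[of "1 - M * w"] w(2) by (simp add: K_def w(3))
  also have "H (of_real t) = of_real (\<gamma> t)"
    using HG[OF of_real_in_heat_disc[OF t]] G\<gamma>[OF t] by simp
  finally have "I = \<gamma> t / sqrt (1 - M * w)"
    by (simp flip: of_real_divide)
  then show "(LINT y|lborel. normal_density 0 (sqrt (2 * t)) y * heat_profile a y) = \<gamma> t"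
    unfolding eq using w(2) by (simp add: I_def)
qed

section \<open>Data depending on one coordinate\<close>

lemma lborel_integral_prod_Basis:
  fixes f :: "'a::euclidean_space \<Rightarrow> real \<Rightarrow> real"
  assumes f: "\<And>b. b \<in> Basis \<Longrightarrow> integrable lborel (f b)"
  shows "integrable lborel (\<lambda>y. \<Prod>b\<in>Basis. f b (y \<bullet> b))"
    and "(LINT y|lborel. (\<Prod>b\<in>Basis. f b (y \<bullet> b))) = (\<Prod>b\<in>Basis. (LINT s|lborel. f b s))"
proof -
  interpret product_sigma_finite "\<lambda>_::'a. lborel :: real measure"
    by standard
  have [measurable]: "f b \<in> borel_measurable borel" if "b \<in> Basis" for b
    using borel_measurable_integrable[OF f[OF that]] by simp
  have eq: "(\<Prod>b\<in>Basis. f b ((\<Sum>i\<in>Basis. g i *\<^sub>R i) \<bullet> b)) = (\<Prod>b\<in>Basis. f b (g b))" for g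
    by (rule prod.cong) auto
  have m1: "(\<lambda>g. \<Sum>b\<in>Basis. g b *\<^sub>R b) \<in> measurable (Pi\<^sub>M Basis (\<lambda>_. lborel)) (borel :: 'a measure)"
    by measurable
  have m2: "(\<lambda>y::'a. \<Prod>b\<in>Basis. f b (y \<bullet> b)) \<in> borel_measurable borel"
    by measurable
  show "integrable lborel (\<lambda>y. \<Prod>b\<in>Basis. f b (y \<bullet> b))"
    unfolding lborel_eq[where 'a = 'a] integrable_distr_eq[OF m1 m2] eq
    by (rule product_integrable_prod) (use f in auto)
  show "(LINT y|lborel. (\<Prod>b\<in>Basis. f b (y \<bullet> b))) = (\<Prod>b\<in>Basis. (LINT s|lborel. f b s))"
    unfolding lborel_eq[where 'a = 'a] integral_distr[OF m1 m2] eq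
    by (rule product_integral_prod) (use f in auto)
qed

lemma gaussian_prod_Basis:
  fixes x y :: "'a::euclidean_space"
  shows "exp (- ((norm (x - y))\<^sup>2 / (4 * t))) = (\<Prod>b\<in>Basis. exp (- ((x \<bullet> b - y \<bullet> b)\<^sup>2 / (4 * t))))"
proof -
  have "(norm (x - y))\<^sup>2 = (\<Sum>b\<in>Basis. (x \<bullet> b - y \<bullet> b)\<^sup>2)"
    unfolding power2_norm_eq_inner by (subst euclidean_inner) (simp add: power2_eq_square inner_diff_left)
  then show ?thesis
    by (simp add: exp_sum sum_divide_distrib flip: sum_negf)
qed

lemma heat_kernel_normal_density:
  assumes "0 < t"
  shows "exp (- ((c - s)\<^sup>2 / (4 * t))) = sqrt (4 * pi * t) * normal_density c (sqrt (2 * t)) s"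
  using assms by (simp add: normal_density_def mult_ac power2_commute)

text \<open>
  A Gaussian with a shifted centre is dominated by a centred one of any larger variance.  Hence
  integrability at the origin for all times below \<open>T\<close> gives it at every point.
\<close>

lemma integrable_shifted_gaussian:
  fixes v :: "real \<Rightarrow> real"
  assumes t: "0 < t" "t < \<tau>" and v: "continuous_on UNIV v"
    and int: "integrable lborel (\<lambda>s. normal_density 0 (sqrt (2 * \<tau>)) s * v s)"
  shows "integrable lborel (\<lambda>s. exp (- ((c - s)\<^sup>2 / (4 * t))) * v s)"
proof (rule Bochner_Integration.integrable_bound)
  let ?C = "exp (c\<^sup>2 / (4 * (\<tau> - t))) * sqrt (4 * pi * \<tau>)"
  show "integrable lborel (\<lambda>s. ?C * (normal_density 0 (sqrt (2 * \<tau>)) s * v s))"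
    by (intro integrable_mult_right int)
  have [measurable]: "v \<in> borel_measurable borel"
    using v by (rule borel_measurable_continuous_onI)
  show "(\<lambda>s. exp (- ((c - s)\<^sup>2 / (4 * t))) * v s) \<in> borel_measurable lborel"
    by measurable
  have "exp (- ((c - s)\<^sup>2 / (4 * t))) \<le> exp (c\<^sup>2 / (4 * (\<tau> - t))) * exp (- ((0 - s)\<^sup>2 / (4 * \<tau>)))" for s
  proof -
    \<comment> \<open>The constant \<open>c\<^sup>2 / (4 (\<tau> - t))\<close> is the maximum of the difference of the exponents over \<open>s\<close>, so
        completing the square leaves no remainder.\<close>
    have "c\<^sup>2 / (4 * (\<tau> - t)) - s\<^sup>2 / (4 * \<tau>) + (c - s)\<^sup>2 / (4 * t)
        = (\<tau> * c - (\<tau> - t) * s)\<^sup>2 / (4 * t * \<tau> * (\<tau> - t))"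
      using t by (simp add: divide_simps) (simp add: power2_eq_square algebra_simps)
    also have "0 \<le> \<dots>"
      using t by simp
    finally show ?thesis
      by (simp flip: exp_add)
  qed
  then have "exp (- ((c - s)\<^sup>2 / (4 * t))) \<le> ?C * normal_density 0 (sqrt (2 * \<tau>)) s" for s
    unfolding heat_kernel_normal_density[OF less_trans[OF t], of 0] by (simp add: mult_ac)
  then show "AE s in lborel. norm (exp (- ((c - s)\<^sup>2 / (4 * t))) * v s)
      \<le> norm (?C * (normal_density 0 (sqrt (2 * \<tau>)) s * v s))"
    using t by (intro AE_I2) (simp add: abs_mult mult_right_mono flip: mult.assoc)
qed

text \<open>
  The heat kernel is a product over the coordinates, and in the directions other than \<open>b0\<close> each
  factor integrates to \<open>sqrt (4 \<pi> t)\<close>, which the normalisation of the kernel cancels.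
\<close>

lemma heat_S_one_coordinate:
  fixes v :: "real \<Rightarrow> real" and b0 :: "'a::euclidean_space"
  assumes b0: "b0 \<in> Basis" and t: "0 < t" and v: "continuous_on UNIV v"
    and int: "\<And>c. integrable lborel (\<lambda>s. exp (- ((c - s)\<^sup>2 / (4 * t))) * v s)"
  shows "integrable lebesgue (heat_integrand t (\<lambda>y. v (y \<bullet> b0)) x)"
    and "heat_S t (\<lambda>y. v (y \<bullet> b0)) x = (LINT s|lborel. normal_density (x \<bullet> b0) (sqrt (2 * t)) s * v s)"
proof -
  define f where "f b s = exp (- ((x \<bullet> b - s)\<^sup>2 / (4 * t))) * (if b = b0 then v s else 1)" for b s
  have one: "(\<Prod>b\<in>Basis. if b = b0 then c else 1) = c" for c :: real
    using b0 by simp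
  have eq: "heat_integrand t (\<lambda>y. v (y \<bullet> b0)) x = (\<lambda>y. \<Prod>b\<in>Basis. f b (y \<bullet> b))"
  proof
    fix y :: 'a
    have "(\<Prod>b\<in>Basis. if b = b0 then v (y \<bullet> b) else 1) = (\<Prod>b\<in>Basis. if b = b0 then v (y \<bullet> b0) else 1)"
      by (intro prod.cong) auto
    then show "heat_integrand t (\<lambda>y. v (y \<bullet> b0)) x y = (\<Prod>b\<in>Basis. f b (y \<bullet> b))"
      by (simp add: heat_integrand_def gaussian_prod_Basis f_def prod.distrib one)
  qed
  have \<sigma>: "0 < sqrt (2 * t)" using t by simp
  have fint: "integrable lborel (f b)" for b
    using int[of "x \<bullet> b"] integrable_normal_density[OF \<sigma>, of "x \<bullet> b"]
    by (cases "b = b0") (simp_all add: f_def[abs_def] heat_kernel_normal_density[OF t])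
  define I where "I = (LINT s|lborel. normal_density (x \<bullet> b0) (sqrt (2 * t)) s * v s)"
  have fval: "(LINT s|lborel. f b s) = sqrt (4 * pi * t) * (if b = b0 then I else 1)" for b
    using integral_normal_density[OF \<sigma>, of "x \<bullet> b"]
    by (cases "b = b0") (simp_all add: f_def heat_kernel_normal_density[OF t] I_def mult.assoc)
  note prod = lborel_integral_prod_Basis[of f, OF fint]
  have meas: "(\<lambda>y. \<Prod>b\<in>Basis. f b (y \<bullet> b)) \<in> borel_measurable lborel"
    using prod(1) by (rule borel_measurable_integrable)
  show "integrable lebesgue (heat_integrand t (\<lambda>y. v (y \<bullet> b0)) x)"
    unfolding eq by (subst integrable_completion[OF meas]) (rule prod(1))
  have "(LINT y|lebesgue. heat_integrand t (\<lambda>y. v (y \<bullet> b0)) x y) = (\<Prod>b\<in>Basis. (LINT s|lborel. f b s))"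
    unfolding eq by (subst integral_completion[OF meas]) (rule prod(2))
  also have "\<dots> = sqrt (4 * pi * t) ^ DIM('a) * I"
    unfolding fval by (simp add: prod.distrib one)
  also have "sqrt (4 * pi * t) ^ DIM('a) = (4 * pi * t) powr (real DIM('a) / 2)"
    using t by (simp add: powr_half_sqrt[symmetric] powr_powr flip: powr_realpow)
  finally show "heat_S t (\<lambda>y. v (y \<bullet> b0)) x = (LINT s|lborel. normal_density (x \<bullet> b0) (sqrt (2 * t)) s * v s)"
    using t by (simp add: heat_S_def I_def)
qed

lemma continuous_in_L1_eps:
  fixes u :: "'a::euclidean_space \<Rightarrow> real"
  assumes u: "continuous_on UNIV u" and t: "0 < t" and int: "integrable lebesgue (heat_integrand t u 0)"
  shows "u \<in> L1_eps (1 / (4 * t))"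
proof -
  have "set_integrable lebesgue K u" if "compact K" for K
  proof -
    have "integrable lborel (\<lambda>x. indicator K x *\<^sub>R u x)"
      by (rule borel_integrable_compact[OF that continuous_on_subset[OF u]]) simp
    then show ?thesis
      unfolding set_integrable_def
      by (subst integrable_completion[OF borel_measurable_integrable])
  qed
  moreover have "integrable lebesgue (\<lambda>x. exp (- (1 / (4 * t) * (norm x)\<^sup>2)) * \<bar>u x\<bar>)"
    using integrable_norm[OF int] by (simp add: heat_integrand_def abs_mult)
  ultimately show ?thesis
    by (simp add: L1_eps_def Lloc1_def)
qed

section \<open>The initial datum\<close>

theorem mainTheorem11:
  fixes \<gamma> :: "real \<Rightarrow> real" and T :: ereal
  assumes "0 < T"
    and "real_analytic_on \<gamma> {t. 0 \<le> t \<and> ereal t < T}"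
    and "extends_to_heat_disc \<gamma> T"
  shows "\<exists>u0 :: 'a::euclidean_space \<Rightarrow> real.
           (\<exists>\<epsilon>>0. u0 \<in> L1_eps \<epsilon>) \<and>
           (\<forall>t. 0 \<le> t \<and> ereal t < T \<longrightarrow>
              heat_S_defined t u0 \<and> heat_S t u0 0 = \<gamma> t)"
proof -
  obtain G where G: "G holomorphic_on heat_disc T"
    and G\<gamma>: "\<And>t. 0 < t \<Longrightarrow> ereal t < T \<Longrightarrow> G (of_real t) = of_real (\<gamma> t)"
    using assms(3) by (auto simp: extends_to_heat_disc_def)
  have zero: "0 \<in> {t. 0 \<le> t \<and> ereal t < T}"
    using assms(1) by (simp add: zero_ereal_def)
  obtain a r0 where r0: "0 < r0"
    and a: "\<And>t. 0 \<le> t \<Longrightarrow> ereal t < T \<Longrightarrow> \<bar>t\<bar> < r0 \<Longrightarrow> (\<lambda>n. a n * t ^ n) sums \<gamma> t"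
    using bspec[OF assms(2)[unfolded real_analytic_on_def] zero] by auto
  have "0 < min (ereal r0) T"
    using r0 assms(1) by simp
  then obtain r where "0 < ereal r" "ereal r < min (ereal r0) T"
    using ereal_dense2 by blast
  then have r: "0 < r" "ereal r < T" "r < r0"
    by auto
  have sums: "(\<lambda>n. a n * t ^ n) sums \<gamma> t" if "0 \<le> t" "t \<le> r" for t
  proof (rule a)
    show "ereal t < T"
      by (rule le_less_trans[OF _ r(2)]) (use that in simp)
  qed (use that r in auto)
  have rep: "integrable lborel (\<lambda>s. normal_density 0 (sqrt (2 * t)) s * heat_profile a s)"
      "(LINT s|lborel. normal_density 0 (sqrt (2 * t)) s * heat_profile a s) = \<gamma> t"
    if "0 < t" "ereal t < T" for t
    by (rule heat_profile_represents[OF assms(1) G G\<gamma> r(1,2) sums that]; simp)+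
  obtain r' where r': "0 < r'" "r' < r"
    using dense[OF r(1)] by blast
  have "summable (\<lambda>n. a n * r ^ n)"
    using sums[of r] r(1) by (auto simp: sums_iff)
  from powser_insidea[OF this, of r'] have "summable (\<lambda>n. \<bar>a n\<bar> * r' ^ n)"
    using r' by (simp add: abs_mult)
  then have cont: "continuous_on UNIV (heat_profile a)"
    using r'(1) by (rule continuous_heat_profile)
  obtain b0 :: 'a where b0: "b0 \<in> Basis"
    using nonempty_Basis by blast
  define u0 where "u0 y = heat_profile a (y \<bullet> b0)" for y
  have int: "integrable lborel (\<lambda>s. exp (- ((c - s)\<^sup>2 / (4 * t))) * heat_profile a s)"
    if t: "0 < t" "ereal t < T" for t c
  proof -
    obtain \<tau> where \<tau>: "t < \<tau>" "ereal \<tau> < T"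
      using ereal_dense2[OF t(2)] by auto
    show ?thesis
      by (rule integrable_shifted_gaussian[OF t(1) \<tau>(1) cont rep(1)[OF less_trans[OF t(1) \<tau>(1)] \<tau>(2)]])
  qed
  have defined: "integrable lebesgue (heat_integrand t u0 x)" if "0 < t" "ereal t < T" for t x
    unfolding u0_def by (rule heat_S_one_coordinate(1)[OF b0 that(1) cont int[OF that]])
  have represents: "heat_S t u0 0 = \<gamma> t" if "0 < t" "ereal t < T" for t
    unfolding u0_def heat_S_one_coordinate(2)[OF b0 that(1) cont int[OF that]] inner_zero_left
    by (rule rep(2)[OF that])
  have at_zero: "heat_S 0 u0 0 = \<gamma> 0"
  proof -
    have "(\<lambda>n. a n * 0 ^ n) sums a 0" "(\<lambda>n. a n / even_moment n * 0 ^ n) sums (a 0 / even_moment 0)"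
      by (rule powser_sums_zero)+
    then have "\<gamma> 0 = a 0" "heat_profile a 0 = a 0"
      using sums_unique2[OF sums[of 0]] r(1) by (auto simp: heat_profile_def sums_iff even_moment_def)
    then show ?thesis
      by (simp add: heat_S_def u0_def)
  qed
  have "continuous_on UNIV u0"
    unfolding u0_def by (rule continuous_on_compose2[OF cont]) (auto intro: continuous_intros)
  then have "u0 \<in> L1_eps (1 / (4 * r))"
    using r(1) defined[OF r(1,2)] by (rule continuous_in_L1_eps)
  moreover have "0 < 1 / (4 * r)"
    using r(1) by simp
  moreover have "heat_S_defined t u0 \<and> heat_S t u0 0 = \<gamma> t" if "0 \<le> t" "ereal t < T" for t
    using that defined[of t] represents[of t] at_zero by (cases "t = 0") (auto simp: heat_S_defined_def)
  ultimately show ?thesis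
    by blast
qed

end
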